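(* If $X$ is a median metric space that is Menger convex, then $\mathrm{MH}_k(X)=0$ for all $k\geq 1$.
   Context: Metric spaces have a finite, symmetric, non-degenerate distance satisfying the triangle inequality. A point $z$ is between $x$ and $y$ if $d(x,y)=d(x,z)+d(z,y)$, strictly between if moreover $z\neq x,y$; $[x,y]$ (resp. $]x,y[$) is the set of points between (resp. strictly between) $x$ and $y$. A metric space is median if for all points $x,y,z$ the intersection $[x,y]\cap[y,z]\cap[x,z]$ consists of a single point. A metric space is Menger convex if $]x,y[$ is nonempty for all $x\ne y$. A $k$-path ($k\ge0$) in $X$ is a sequence $\langle x_0,\dots,x_k\rangle$ of points of $X$ with $x_i\ne x_{i+1}$ for $0\le i<k$. Magnitude complex: $\mathrm{MC}_k(X)$ is the free abelian group on the $k$-paths of $X$, with boundary $\partial_k=\sum_{i=1}^{k-1}(-1)^i\partial_{k,i}$, where $\partial_{k,i}\langle x_0,\dots,x_k\rangle=\langle x_0,\dots,\widehat{x_i},\dots,x_k\rangle$ if $x_i$ is between $x_{i-1}$ and $x_{i+1}$, and $0$ otherwise. $\mathrm{MH}_*(X)$ is its homology. *)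

theory Defs
  imports
    "HOL-Analysis.Abstract_Metric_Spaces"
    "HOL-Algebra.Free_Abelian_Groups"
    "HOL-Algebra.Elementary_Groups"
begin

context Metric_space
begin

definition interval :: "'a \<Rightarrow> 'a \<Rightarrow> 'a set"
  where "interval x y = {z \<in> M. d x y = d x z + d z y}"

definition open_interval :: "'a \<Rightarrow> 'a \<Rightarrow> 'a set"
  where "open_interval x y = interval x y - {x, y}"

definition median :: bool
  where "median \<longleftrightarrow>
    (\<forall>x\<in>M. \<forall>y\<in>M. \<forall>z\<in>M. \<exists>m. interval x y \<inter> interval y z \<inter> interval x z = {m})"

definition Menger_convex :: bool
  where "Menger_convex \<longleftrightarrow> (\<forall>x\<in>M. \<forall>y\<in>M. x \<noteq> y \<longrightarrow> open_interval x y \<noteq> {})"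

text \<open>The sequence \<open>\<langle>x\<^sub>0, \<dots>, x\<^sub>k\<rangle>\<close> is encoded as the list \<open>[x\<^sub>0, \<dots>, x\<^sub>k]\<close>, of length \<open>k + 1\<close>.\<close>

definition paths :: "nat \<Rightarrow> 'a list set"
  where "paths k = {xs. length xs = Suc k \<and> set xs \<subseteq> M \<and> (\<forall>i<k. xs ! i \<noteq> xs ! Suc i)}"

definition magnitude_chain_group :: "nat \<Rightarrow> ('a list \<Rightarrow>\<^sub>0 int) monoid"
  where "magnitude_chain_group k = free_Abelian_group (paths k)"

text \<open>The face \<open>\<partial>\<^bsub>k,i\<^esub>\<close> of a basis element \<open>xs\<close>; it is only used for \<open>0 < i < k\<close>, where \<open>k + 1\<close> is
  the length of \<open>xs\<close>. If \<open>xs ! i\<close> lies between its neighbours, these are distinct, so deleting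
  \<open>xs ! i\<close> again yields a path.\<close>

definition path_face :: "nat \<Rightarrow> 'a list \<Rightarrow> ('a list \<Rightarrow>\<^sub>0 int)"
  where "path_face i xs =
    (if xs ! i \<in> interval (xs ! (i - 1)) (xs ! (i + 1))
     then frag_of (take i xs @ drop (i + 1) xs) else 0)"

definition magnitude_boundary :: "nat \<Rightarrow> ('a list \<Rightarrow>\<^sub>0 int) \<Rightarrow> ('a list \<Rightarrow>\<^sub>0 int)"
  where "magnitude_boundary k =
    frag_extend (\<lambda>xs. \<Sum>i = 1..<k. frag_cmul ((-1) ^ i) (path_face i xs))"

text \<open>For \<open>k = 0\<close> the index \<open>k - 1\<close> is truncated to \<open>0\<close>. This is harmless: \<open>magnitude_boundary 0\<close>
  is the zero map, so every 0-chain is a cycle.\<close>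

definition magnitude_cycles :: "nat \<Rightarrow> ('a list \<Rightarrow>\<^sub>0 int) set"
  where "magnitude_cycles k =
    kernel (magnitude_chain_group k) (magnitude_chain_group (k - 1)) (magnitude_boundary k)"

definition magnitude_boundaries :: "nat \<Rightarrow> ('a list \<Rightarrow>\<^sub>0 int) set"
  where "magnitude_boundaries k =
    magnitude_boundary (Suc k) ` carrier (magnitude_chain_group (Suc k))"

definition magnitude_homology :: "nat \<Rightarrow> ('a list \<Rightarrow>\<^sub>0 int) set monoid"
  where "magnitude_homology k =
    subgroup_generated (magnitude_chain_group k) (magnitude_cycles k) Mod magnitude_boundaries k"

end

end

theory Submission
  imports Defs
begin

text \<open>Call \<open>x\<close> below \<open>y\<close>, relative to a base point \<open>p\<close>, if \<open>x\<close> is between \<open>p\<close> and \<open>y\<close>. In a median space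
  this is a meet-semilattice in which every interval \<open>interval p x\<close> is a distributive lattice, with
  meets \<open>med p u v\<close> and joins \<open>med x u v\<close>. Distributivity (\<open>med_distrib\<close>) comes from the uniqueness of
  medians: the lattice polynomial for the median and its dual both describe it.

  A \<open>k\<close>-cycle with \<open>k \<ge> 1\<close> involves only a finite set \<open>V\<close> of points. To fill it, a new vertex is
  inserted after the first vertex \<open>p\<close> of each path. If the path goes on to \<open>x\<close>, the inserted point
  \<open>u x\<close> has to be strictly between \<open>p\<close> and \<open>x\<close>, monotone in \<open>x\<close>, and so close to \<open>p\<close> that \<open>x\<close> is
  between \<open>u x\<close> and \<open>y\<close> only if it is between \<open>p\<close> and \<open>y\<close>, for \<open>y\<close> in \<open>V\<close>. Such a \<open>u\<close> exists
  (\<open>first_step_exists\<close>): close \<open>V\<close> under meets, choose by Menger convexity a point strictly between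
  \<open>p\<close> and each atom of the resulting finite semilattice, and let \<open>u x\<close> be the join of the points chosen
  for the atoms below \<open>x\<close>. Monotonicity is immediate, and distributivity gives the rest.

  Inserting \<open>u x\<close> alone does not contract the cycle, since the inserted point changes when \<open>x\<close> is
  omitted from the path.
  The remedy is the usual prism: for every initial chain \<open>p < x\<^sub>1 < \<dots> < x\<^sub>j\<close> of the path one adds the
  path \<open>p, u x\<^sub>1, \<dots>, u x\<^sub>j, x\<^sub>j, \<dots>, x\<^sub>k\<close> with sign \<open>(-1) ^ j\<close>. All faces cancel in pairs except the
  original path (\<open>contraction_identity\<close>), so every cycle supported on \<open>V\<close> is a boundary in the whole
  space.\<close>

section \<open>Intervals in metric spaces\<close>

context Metric_space
begin

lemma interval_commute: "interval x y = interval y x"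
  by (auto simp: interval_def commute)

lemma interval_endpoints: "\<lbrakk>x \<in> M; y \<in> M\<rbrakk> \<Longrightarrow> x \<in> interval x y \<and> y \<in> interval x y"
  by (simp add: interval_def)

lemma interval_in_space: "z \<in> interval x y \<Longrightarrow> z \<in> M"
  by (simp add: interval_def)

lemma interval_same: "x \<in> M \<Longrightarrow> z \<in> interval x x \<Longrightarrow> z = x"
  using nonneg[of x z] by (auto simp: interval_def commute)

text \<open>Fixing a point \<open>p\<close>, the relation \<open>x \<in> interval p y\<close> is a partial order on the space with least
  element \<open>p\<close>. This lemma is its transitivity, together with the fact that intervals of this order
  are metric intervals; all later arguments about betweenness are made inside this order.\<close>

lemma interval_nested:
  assumes "x \<in> M" "z \<in> M" "y \<in> interval x z" "w \<in> interval x y"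
  shows "w \<in> interval x z" and "y \<in> interval w z"
proof -
  have "w \<in> M" "y \<in> M" "d x z = d x y + d y z" "d x y = d x w + d w y"
    using assms by (auto simp: interval_def)
  moreover have "d x z \<le> d x w + d w z" "d w z \<le> d w y + d y z"
    using triangle assms(1,2) calculation by blast+
  ultimately have "d x z = d x w + d w z" "d w z = d w y + d y z"
    by linarith+
  then show "w \<in> interval x z" "y \<in> interval w z"
    using \<open>w \<in> M\<close> \<open>y \<in> M\<close> by (auto simp: interval_def)
qed

lemma interval_antisym:
  assumes "p \<in> M" "x \<in> interval p y" "y \<in> interval p x"
  shows "x = y"
proof -
  have "d x y = 0"
    using assms nonneg[of x y] commute[of x y] by (auto simp: interval_def)
  then show ?thesis
    using assms by (simp add: interval_def)
qed

text \<open>Least upper bounds in the order \<open>x \<in> interval p y\<close>. They are taken in the whole space, not only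
  below a fixed upper bound, so that the least upper bounds of sets with different upper bounds can
  be compared.\<close>

definition is_lub :: "'a \<Rightarrow> 'a set \<Rightarrow> 'a \<Rightarrow> bool"
  where "is_lub p S z \<longleftrightarrow> z \<in> M \<and> (\<forall>s\<in>S. s \<in> interval p z) \<and>
    (\<forall>w\<in>M. (\<forall>s\<in>S. s \<in> interval p w) \<longrightarrow> z \<in> interval p w)"

lemma is_lub_unique:
  assumes "p \<in> M" "is_lub p S y" "is_lub p S z"
  shows "y = z"
proof -
  have "y \<in> interval p z" "z \<in> interval p y"
    using assms unfolding is_lub_def by blast+
  then show ?thesis
    using interval_antisym assms(1) by blast
qed

end

section \<open>Intervals in median spaces are distributive lattices\<close>

locale median_space = Metric_space +
  assumes median: median
begin

definition med :: "'a \<Rightarrow> 'a \<Rightarrow> 'a \<Rightarrow> 'a"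
  where "med x y z = (THE m. m \<in> interval x y \<inter> interval y z \<inter> interval x z)"

lemma
  assumes "x \<in> M" "y \<in> M" "z \<in> M"
  shows med_between: "med x y z \<in> interval x y" "med x y z \<in> interval y z" "med x y z \<in> interval x z"
    and med_unique: "\<lbrakk>m \<in> interval x y; m \<in> interval y z; m \<in> interval x z\<rbrakk> \<Longrightarrow> m = med x y z"
proof -
  obtain n where n: "interval x y \<inter> interval y z \<inter> interval x z = {n}"
    using median assms unfolding median_def by blast
  then have "med x y z = n"
    unfolding med_def by auto
  then show "med x y z \<in> interval x y" "med x y z \<in> interval y z" "med x y z \<in> interval x z"
    "\<lbrakk>m \<in> interval x y; m \<in> interval y z; m \<in> interval x z\<rbrakk> \<Longrightarrow> m = med x y z"
    using n by auto
qed

lemma med_in_space: "\<lbrakk>x \<in> M; y \<in> M; z \<in> M\<rbrakk> \<Longrightarrow> med x y z \<in> M"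
  using med_between interval_in_space by blast

text \<open>The median with \<open>p\<close> is the meet in the order based at \<open>p\<close>: if \<open>z\<close> is below \<open>x\<close> and \<open>y\<close>, the median
  of \<open>z\<close>, \<open>x\<close> and \<open>y\<close> lies above \<open>z\<close> and satisfies the conditions that determine the median of \<open>p\<close>,
  \<open>x\<close> and \<open>y\<close>.\<close>

lemma med_greatest:
  assumes "p \<in> M" "x \<in> M" "y \<in> M" "z \<in> interval p x" "z \<in> interval p y"
  shows "z \<in> interval p (med p x y)"
proof -
  have z: "z \<in> M"
    using assms interval_in_space by blast
  define q where "q = med z x y"
  have q: "q \<in> interval z x" "q \<in> interval x y" "q \<in> interval z y" "q \<in> M"
    using med_between[of z x y] z assms interval_in_space unfolding q_def by auto
  have "q \<in> interval p x" "q \<in> interval p y" "z \<in> interval p q"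
    using interval_nested[of x p z q] interval_nested[of y p z q] assms q
    by (auto simp: interval_commute)
  moreover have "q = med p x y"
    using med_unique[of p x y q] calculation q assms by auto
  ultimately show ?thesis
    by simp
qed

text \<open>Reading \<open>interval p x\<close> from \<open>x\<close> reverses the order, so the join of two elements below \<open>x\<close> is their
  median with \<open>x\<close>. For another upper bound \<open>w\<close>, the same construction below the meet of \<open>x\<close> and \<open>w\<close>
  satisfies the conditions that determine \<open>med x u v\<close>; so the join does not depend on the bound.\<close>

lemma med_is_lub:
  assumes "p \<in> M" "x \<in> M" "u \<in> interval p x" "v \<in> interval p x"
  shows "is_lub p {u, v} (med x u v)"
proof -
  have M: "u \<in> M" "v \<in> M"
    using assms interval_in_space by auto
  have upper: "u \<in> interval p (med y u v)" "v \<in> interval p (med y u v)" "med y u v \<in> interval p y"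
    if "y \<in> M" "u \<in> interval p y" "v \<in> interval p y" for y
  proof -
    have "med y u v \<in> interval y u" "med y u v \<in> interval y v"
      using med_between that M by auto
    then show "u \<in> interval p (med y u v)" "v \<in> interval p (med y u v)" "med y u v \<in> interval p y"
      using interval_nested[of y p u "med y u v"] interval_nested[of y p v "med y u v"] assms that M
      by (auto simp: interval_commute)
  qed
  have "med x u v \<in> interval p w" if w: "w \<in> M" "u \<in> interval p w" "v \<in> interval p w" for w
  proof -
    define y where "y = med p x w"
    have y: "y \<in> M" "y \<in> interval p x" "y \<in> interval p w"
      using med_between[of p x w] med_in_space assms w unfolding y_def by auto
    have uv: "u \<in> interval p y" "v \<in> interval p y"
      using med_greatest assms w unfolding y_def by auto
    define j where "j = med y u v"
    have j: "u \<in> interval p j" "v \<in> interval p j" "j \<in> interval p y" "j \<in> interval u v"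
      using upper[OF y(1) uv] med_between[of y u v] y M unfolding j_def by auto
    then have "j \<in> interval p x"
      using interval_nested[of p x y j] assms y by auto
    then have "j \<in> interval u x" "j \<in> interval v x"
      using interval_nested[of p x j u] interval_nested[of p x j v] assms j by auto
    then have "j = med x u v"
      using med_unique[of x u v j] j assms M by (auto simp: interval_commute)
    then show ?thesis
      using interval_nested[of p w y j] assms w y j by auto
  qed
  then show ?thesis
    using upper[OF assms(2-4)] assms M by (auto simp: is_lub_def med_in_space)
qed

text \<open>The height \<open>d p\<close> is a modular valuation, since the distance of \<open>u\<close> and \<open>v\<close> is the length of a path
  through the meet as well as of one through the join.\<close>

lemma dist_med_modular:
  assumes "p \<in> M" "x \<in> M" "u \<in> interval p x" "v \<in> interval p x"
  shows "d p u + d p v = d p (med p u v) + d p (med x u v)"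
proof -
  have M: "u \<in> M" "v \<in> M"
    using assms interval_in_space by auto
  have "is_lub p {u, v} (med x u v)"
    using med_is_lub assms by blast
  then have "u \<in> interval p (med x u v)" "v \<in> interval p (med x u v)"
    by (auto simp: is_lub_def)
  moreover have "med x u v \<in> interval u v"
    using med_between assms M by blast
  moreover have "med p u v \<in> interval u v" "med p u v \<in> interval p u" "med p u v \<in> interval p v"
    using med_between assms M by blast+
  ultimately show ?thesis
    by (auto simp: interval_def commute)
qed

text \<open>By modularity the path from \<open>u\<close> down to \<open>a\<close>, up to \<open>z\<close>, down to \<open>b\<close> and up to \<open>v\<close> is at most
  as long as the one through the meet of \<open>u\<close> and \<open>v\<close>.\<close>

lemma join_between:
  assumes "p \<in> M" "x \<in> M" "u \<in> interval p x" "v \<in> interval p x"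
    and a: "a \<in> interval p u" "med p u v \<in> interval p a"
    and b: "b \<in> interval p v" "med p u v \<in> interval p b"
    and z: "is_lub p {a, b} z"
  shows "z \<in> interval u v"
proof -
  have M: "u \<in> M" "v \<in> M" "a \<in> M" "b \<in> M" "z \<in> M"
    using assms interval_in_space is_lub_def by auto
  have ab: "a \<in> interval p x" "b \<in> interval p x"
    using interval_nested assms by blast+
  then have z_eq: "z = med x a b"
    using med_is_lub is_lub_unique assms by blast
  have az: "a \<in> interval p z" "b \<in> interval p z"
    using z by (auto simp: is_lub_def)
  have "d p a + d p b = d p (med p a b) + d p z"
    using dist_med_modular assms ab z_eq by blast
  moreover have "med p u v \<in> interval p (med p a b)"
    using med_greatest a b M assms(1) by blast
  moreover have "d u z \<le> d a u + d a z" "d z v \<le> d b z + d b v"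
    using triangle'' M by (metis commute)+
  moreover have "d u v = d u (med p u v) + d (med p u v) v"
    "d p u = d p (med p u v) + d (med p u v) u" "d p v = d p (med p u v) + d (med p u v) v"
    using med_between[of p u v] M assms(1) by (auto simp: interval_def)
  moreover have "d u v \<le> d u z + d z v"
    using triangle M by blast
  moreover have "d p u = d p a + d a u" "d p v = d p b + d b v" "d p z = d p a + d a z" "d p z = d p b + d b z"
    using a b az by (auto simp: interval_def)
  moreover have "d p (med p u v) \<le> d p (med p a b)"
    using calculation(2) nonneg by (auto simp: interval_def)
  ultimately have "d u v = d u z + d z v"
    using commute[of u "med p u v"] by linarith
  then show ?thesis
    using M by (simp add: interval_def)
qed

lemma med_swap:
  assumes "x \<in> M" "y \<in> M" "z \<in> M"
  shows "med x z y = med x y z"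
  using med_unique[of x y z "med x z y"] med_between[of x z y] assms
  by (auto simp: interval_commute)

lemma is_lub_exists:
  assumes "finite S" "p \<in> M" "x \<in> M" "\<And>s. s \<in> S \<Longrightarrow> s \<in> interval p x"
  shows "\<exists>z. is_lub p S z"
  using assms(1,4)
proof (induction S rule: finite_induct)
  case empty
  then show ?case
    using assms(2) interval_endpoints by (auto simp: is_lub_def intro!: exI[of _ p])
next
  case (insert b S)
  then obtain z where z: "is_lub p S z"
    by auto
  then have "z \<in> interval p x" "b \<in> interval p x"
    using insert assms(3) by (auto simp: is_lub_def)
  then have y: "is_lub p {b, z} (med x b z)"
    using med_is_lub assms by auto
  have "is_lub p (insert b S) (med x b z)"
    unfolding is_lub_def
  proof (intro conjI ballI impI)
    show "med x b z \<in> M"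
      using y by (simp add: is_lub_def)
    fix s assume "s \<in> insert b S"
    then show "s \<in> interval p (med x b z)"
      using y z interval_nested(1)[of p "med x b z" z s] assms(2)
      by (auto simp: is_lub_def)
  next
    fix w assume "w \<in> M" "\<forall>s\<in>insert b S. s \<in> interval p w"
    then show "med x b z \<in> interval p w"
      using y z by (auto simp: is_lub_def)
  qed
  then show ?case
    by blast
qed

lemma is_lub_insert:
  assumes "p \<in> M" "is_lub p S z" "is_lub p (insert b S) y"
  shows "is_lub p {b, z} y"
  unfolding is_lub_def
proof (intro conjI ballI impI)
  show "y \<in> M"
    using assms by (simp add: is_lub_def)
  fix s assume "s \<in> {b, z}"
  then show "s \<in> interval p y"
    using assms by (auto simp: is_lub_def)
next
  fix w assume w: "w \<in> M" "\<forall>s\<in>{b, z}. s \<in> interval p w"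
  have "s \<in> interval p w" if "s \<in> S" for s
    using that w assms(1,2) interval_nested(1)[of p w z s] by (auto simp: is_lub_def)
  then show "y \<in> interval p w"
    using w assms(3) by (auto simp: is_lub_def)
qed

text \<open>The median of three bounded elements is given by the lattice polynomial for medians: the join of
  the pairwise meets lies between any two of the three elements by \<open>join_between\<close>, and the
  median is the only such point.\<close>

lemma med_is_lub_of_meets:
  assumes "p \<in> M" "x \<in> M" "u \<in> interval p x" "v \<in> interval p x" "w \<in> interval p x"
  shows "is_lub p {med p u v, med p u w, med p v w} (med u v w)"
proof -
  have M: "u \<in> M" "v \<in> M" "w \<in> M"
    using assms interval_in_space by auto
  have meets: "med p a b \<in> interval p a" "med p a b \<in> interval p b" "med p a b \<in> interval p x"
    if "a \<in> {u, v, w}" "b \<in> {u, v, w}" for a b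
    using med_between[of p a b] interval_nested(1)[of p x a "med p a b"] that assms M by auto
  obtain z where z: "is_lub p {med p u v, med p u w, med p v w} z"
    using is_lub_exists[of "{med p u v, med p u w, med p v w}" p x] meets assms(1,2)
    by (metis empty_iff finite.emptyI finite.insertI insert_iff)
  have sub: "z \<in> interval a b"
    if abc: "{med p a b, med p a c, med p b c} = {med p u v, med p u w, med p v w}"
      "a \<in> {u, v, w}" "b \<in> {u, v, w}" "c \<in> {u, v, w}" for a b c
  proof -
    obtain s where s: "is_lub p {med p a b, med p a c} s"
      using is_lub_exists[of "{med p a b, med p a c}" p x] meets[OF abc(2,3)] meets[OF abc(2,4)] assms by auto
    obtain t where t: "is_lub p {med p a b, med p b c} t"
      using is_lub_exists[of "{med p a b, med p b c}" p x] meets[OF abc(2,3)] meets[OF abc(3,4)] assms by auto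
    have ab: "a \<in> M" "b \<in> M" "a \<in> interval p x" "b \<in> interval p x"
      using abc M assms by auto
    have z': "is_lub p {med p a b, med p a c, med p b c} z"
      using z abc by simp
    have "is_lub p {s, t} z"
      unfolding is_lub_def
    proof (intro conjI ballI impI)
      show "z \<in> M"
        using z by (simp add: is_lub_def)
      fix r assume "r \<in> {s, t}"
      then show "r \<in> interval p z"
        using s t z' by (auto simp: is_lub_def)
    next
      fix y assume y: "y \<in> M" "\<forall>r\<in>{s, t}. r \<in> interval p y"
      have "r \<in> interval p y" if "r \<in> {med p a b, med p a c, med p b c}" for r
        using that y s t interval_nested(1)[of p y s r] interval_nested(1)[of p y t r] assms(1)
        by (auto simp: is_lub_def)
      then show "z \<in> interval p y"
        using y z' by (auto simp: is_lub_def)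
    qed
    moreover have "s \<in> interval p a" "t \<in> interval p b"
      using s t meets abc ab by (auto simp: is_lub_def)
    ultimately show ?thesis
      using join_between[of p x a b s t z] s t ab assms by (auto simp: is_lub_def)
  qed
  have swap: "med p v u = med p u v" "med p w u = med p u w" "med p w v = med p v w"
    using med_swap assms(1) M by auto
  have "z \<in> interval u v" "z \<in> interval v w" "z \<in> interval u w"
    using sub[of u v w] sub[of v w u] sub[of u w v] swap by (auto simp: insert_commute)
  then have "z = med u v w"
    using med_unique M by auto
  then show ?thesis
    using z by simp
qed

text \<open>Distributivity. Uniqueness of medians equates the lattice polynomial for the median of \<open>c\<close>, \<open>u\<close>,
  \<open>v\<close> with its dual, and the dual one lies above \<open>c\<close> because \<open>c\<close> is below the join of \<open>u\<close> and \<open>v\<close>.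
  So \<open>c\<close> is below the join of all three pairwise meets; the valuation then shows that the two meets
  with \<open>c\<close> already have join \<open>c\<close>.\<close>

lemma med_distrib:
  assumes "p \<in> M" "is_lub p {u, v} j" "c \<in> interval p j"
  shows "is_lub p {med p c u, med p c v} c"
proof -
  have uv: "j \<in> M" "u \<in> interval p j" "v \<in> interval p j"
    using assms by (auto simp: is_lub_def)
  have M: "u \<in> M" "v \<in> M" "c \<in> M"
    using assms uv interval_in_space by auto
  define n where "n = med c u v"
  have n: "is_lub p {med p c u, med p c v, med p u v} n"
    unfolding n_def using med_is_lub_of_meets[of p j c u v] assms uv by auto
  have "n \<in> M"
    using n by (simp add: is_lub_def)
  \<comment> \<open>Seen from \<open>j\<close> the order is reversed, so meets become joins, and \<open>med j u v\<close> is the greatest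
    element \<open>j\<close> itself. Hence \<open>c\<close> is an upper bound of the three elements.\<close>
  have dual: "is_lub j {med j c u, med j c v, med j u v} n"
    unfolding n_def using med_is_lub_of_meets[of j p c u v] assms uv by (auto simp: interval_commute)
  have "med j u v = j"
    using is_lub_unique[of p "{u, v}"] med_is_lub[of p j u v] assms uv by blast
  then have "n \<in> interval j c"
    using dual M uv med_between[of j c u] med_between[of j c v] interval_endpoints[of j c]
    by (auto simp: is_lub_def)
  then have cn: "c \<in> interval p n"
    using interval_nested(2)[of j p c n] assms uv by (auto simp: interval_commute)
  have nj: "n \<in> interval p j"
    using \<open>n \<in> interval j c\<close> interval_nested(1)[of j p c n] assms uv by (auto simp: interval_commute)
  obtain q where q: "is_lub p {med p c u, med p c v} q"
    using is_lub_exists[of "{med p c u, med p c v}" p c] assms M med_between[of p c u] med_between[of p c v]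
    by auto
  have qc: "q \<in> interval p c" "q \<in> M"
    using q M assms med_between[of p c u] med_between[of p c v] by (auto simp: is_lub_def)
  define t where "t = med p u v"
  have t: "t \<in> M" "t \<in> interval p n" "t \<in> interval p u" "t \<in> interval p v"
    using n M assms(1) med_between[of p u v] interval_in_space unfolding t_def
    by (auto simp: is_lub_def)
  have "is_lub p {t, q} n"
    using is_lub_insert[of p "{med p c u, med p c v}" q t n] n q assms(1) unfolding t_def
    by (simp add: insert_commute)
  then have qt: "is_lub p {q, t} n"
    by (simp add: insert_commute)
  have qn: "q \<in> interval p n"
    using qt by (simp add: is_lub_def)
  have "is_lub p {c, t} n"
    unfolding is_lub_def
  proof (intro conjI ballI impI)
    fix w assume w: "w \<in> M" "\<forall>s\<in>{c, t}. s \<in> interval p w"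
    then have "q \<in> interval p w"
      using interval_nested(1)[of p w c q] qc assms(1) by auto
    then show "n \<in> interval p w"
      using qt w by (auto simp: is_lub_def)
  qed (use \<open>n \<in> M\<close> cn t in auto)
  then have "med n c t = n"
    using is_lub_unique[of p "{c, t}"] med_is_lub[of p n c t] \<open>n \<in> M\<close> cn t assms(1) by blast
  moreover have "med n q t = n"
    using is_lub_unique[of p "{q, t}"] med_is_lub[of p n q t] qt \<open>n \<in> M\<close> qn t assms(1) by blast
  ultimately have "d p c - d p q = d p (med p c t) - d p (med p q t)"
    using dist_med_modular[of p n c t] dist_med_modular[of p n q t] assms(1) \<open>n \<in> M\<close> cn t qn by auto
  moreover have "med p c t \<in> interval p (med p q t)"
  proof -
    have ct: "med p c t \<in> interval p c" "med p c t \<in> interval p t"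
      using med_between[of p c t] assms(1) M t by auto
    then have "med p c t \<in> interval p u"
      using interval_nested(1)[of p u t "med p c t"] assms(1) M t by auto
    then have "med p c t \<in> interval p (med p c u)"
      using med_greatest ct assms(1) M by blast
    moreover have "med p c u \<in> interval p q"
      using q by (simp add: is_lub_def)
    ultimately have "med p c t \<in> interval p q"
      using interval_nested(1)[of p q "med p c u" "med p c t"] assms(1) qc by auto
    then show ?thesis
      using med_greatest[of p q t] ct assms(1) qc t by auto
  qed
  then have "d p (med p c t) \<le> d p (med p q t)"
    using nonneg by (auto simp: interval_def)
  moreover have "d p c = d p q + d q c"
    using qc by (simp add: interval_def)
  ultimately have "d q c = 0"
    using nonneg[of q c] by linarith
  then have "q = c"
    using qc M by simp
  then show ?thesis
    using q by simp
qed

text \<open>Distributivity in the form of an upper bound, which can be iterated over a finite join.\<close>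

lemma med_join_le:
  assumes "p \<in> M" "a \<in> M" "w \<in> M" "is_lub p {u, v} j"
    and "med p a u \<in> interval p w" "med p a v \<in> interval p w"
  shows "med p a j \<in> interval p w"
proof -
  have j: "j \<in> M" "u \<in> M" "v \<in> M"
    using assms interval_in_space by (auto simp: is_lub_def)
  define c where "c = med p a j"
  have c: "c \<in> M" "c \<in> interval p a" "c \<in> interval p j"
    using med_between[of p a j] med_in_space assms(1,2) j unfolding c_def by auto
  have "med p c b \<in> interval p w" if "b \<in> M" "med p a b \<in> interval p w" for b
  proof -
    have "med p c b \<in> interval p c" "med p c b \<in> interval p b"
      using med_between[of p c b] assms(1) c that by auto
    then have "med p c b \<in> interval p (med p a b)"
      using med_greatest interval_nested(1)[of p a c "med p c b"] assms(1,2) c that by blast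
    then show ?thesis
      using interval_nested(1)[of p w "med p a b" "med p c b"] assms(1,3) that by blast
  qed
  moreover have "is_lub p {med p c u, med p c v} c"
    using med_distrib assms(1,4) c by blast
  ultimately show ?thesis
    using assms j unfolding c_def[symmetric] is_lub_def by auto
qed

lemma med_lub_le:
  assumes "finite S" "p \<in> M" "a \<in> M" "w \<in> M" "is_lub p S z"
    and "\<And>s. s \<in> S \<Longrightarrow> med p a s \<in> interval p w"
  shows "med p a z \<in> interval p w"
  using assms(1,5,6)
proof (induction S arbitrary: z rule: finite_induct)
  case empty
  then have "z = p"
    using is_lub_unique[of p "{}" z p] assms(2) interval_endpoints by (auto simp: is_lub_def)
  then have "med p a z = p"
    using med_between[of p a p] interval_same assms(2,3) by blast
  then show ?case
    using assms interval_endpoints by simp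
next
  case (insert b S)
  have z: "z \<in> M" "\<And>s. s \<in> S \<Longrightarrow> s \<in> interval p z"
    using insert by (auto simp: is_lub_def)
  obtain y where y: "is_lub p S y"
    using is_lub_exists[of S p z] insert z assms by auto
  then have "med p a y \<in> interval p w"
    using insert by auto
  moreover have "is_lub p {b, y} z"
    using is_lub_insert y insert assms(2) by blast
  ultimately show ?case
    using med_join_le insert assms by blast
qed

end

section \<open>The contracting homotopy\<close>

definition prepend :: "'b \<Rightarrow> ('b list \<Rightarrow>\<^sub>0 int) \<Rightarrow> ('b list \<Rightarrow>\<^sub>0 int)"
  where "prepend x = frag_extend (\<lambda>xs. frag_of (x # xs))"

lemma prepend_simps [simp]:
  "prepend x 0 = 0" "prepend x (frag_of xs) = frag_of (x # xs)" "prepend x (- a) = - prepend x a"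
  "prepend x (a + b) = prepend x a + prepend x b" "prepend x (a - b) = prepend x a - prepend x b"
  by (simp_all add: prepend_def frag_extend_add frag_extend_diff frag_extend_minus)

lemma keys_prepend: "Poly_Mapping.keys (prepend x c) \<subseteq> (#) x ` Poly_Mapping.keys c"
  using keys_frag_extend[of "\<lambda>xs. frag_of (x # xs)" c] by (auto simp: prepend_def)

abbreviation starts_with :: "'b \<Rightarrow> ('b list \<Rightarrow>\<^sub>0 int) \<Rightarrow> bool"
  where "starts_with x c \<equiv> Poly_Mapping.keys c \<subseteq> range ((#) x)"

context Metric_space
begin

text \<open>A choice, for the paths starting at \<open>p\<close>, of a point \<open>u x\<close> to be inserted between \<open>p\<close> and a second
  vertex \<open>x\<close>. By monotonicity the steps to the points of a chain \<open>p < x\<^sub>1 < x\<^sub>2 < \<dots>\<close> again form a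
  chain. The last condition says that replacing \<open>p\<close> by \<open>u x\<close> creates no new betweenness relation at
  \<open>x\<close>; this makes the face of a path that omits \<open>x\<close> survive exactly when it survives after
  insertion.\<close>

definition first_step :: "'a \<Rightarrow> 'a set \<Rightarrow> ('a \<Rightarrow> 'a) \<Rightarrow> bool"
  where "first_step p V u \<longleftrightarrow> p \<in> M \<and> V \<subseteq> M \<and>
    (\<forall>x\<in>V - {p}. u x \<in> open_interval p x) \<and>
    (\<forall>x\<in>V - {p}. \<forall>y\<in>V - {p}. x \<in> interval p y \<longrightarrow> u x \<in> interval p (u y)) \<and>
    (\<forall>x\<in>V - {p}. \<forall>y\<in>V. x \<in> interval (u x) y \<longrightarrow> x \<in> interval p y)"

text \<open>The boundary of a path by recursion on its first vertex. Passing to the tail shifts the positions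
  of the remaining vertices by one, hence the sign in front of the recursive term.\<close>

fun path_boundary :: "'a list \<Rightarrow> ('a list \<Rightarrow>\<^sub>0 int)"
  where
    "path_boundary (x # y # z # r) =
      (if y \<in> interval x z then - frag_of (x # z # r) else 0) - prepend x (path_boundary (y # z # r))"
  | "path_boundary [] = 0"
  | "path_boundary [x] = 0"
  | "path_boundary [x, y] = 0"

text \<open>For a path \<open>p, x\<^sub>1, \<dots>, x\<^sub>k\<close> whose vertices up to \<open>x\<^sub>j\<close> form a chain above \<open>p\<close>, the \<open>j\<close>-th prism
  term is the path \<open>p, u x\<^sub>1, \<dots>, u x\<^sub>j, x\<^sub>j, \<dots>, x\<^sub>k\<close> with sign \<open>(-1) ^ j\<close>. This function gives the
  sum of these terms with the common vertex \<open>p\<close> removed; the terms with \<open>u x\<^sub>i = u x\<^sub>i\<^sub>+\<^sub>1\<close> are not paths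
  and count as \<open>0\<close>.\<close>

fun prism :: "'a \<Rightarrow> ('a \<Rightarrow> 'a) \<Rightarrow> 'a list \<Rightarrow> ('a list \<Rightarrow>\<^sub>0 int)"
  where
    "prism p u [] = 0"
  | "prism p u [x] = - frag_of [u x, x]"
  | "prism p u (x # y # r) = - frag_of (u x # x # y # r) -
      (if x \<in> interval p y \<and> u x \<noteq> u y then prepend (u x) (prism p u (y # r)) else 0)"

lemma path_boundary_starts_with: "starts_with x (path_boundary (x # r))"
proof (cases "(x # r)" rule: path_boundary.cases)
  case (1 x' y z r')
  then show ?thesis
    using keys_diff[of "if y \<in> interval x z then - frag_of (x # z # r') else 0"
        "prepend x (path_boundary (y # z # r'))"] keys_prepend[of x "path_boundary (y # z # r')"]
    by (auto split: if_splits)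
qed auto

lemma prism_starts_with: "starts_with (u x) (prism p u (x # r))"
proof (cases r)
  case (Cons y r')
  then show ?thesis
    using keys_diff[of "- frag_of (u x # x # y # r')"
        "if x \<in> interval p y \<and> u x \<noteq> u y then prepend (u x) (prism p u (y # r')) else 0"]
      keys_prepend[of "u x" "prism p u (y # r')"]
    by (auto split: if_splits)
qed auto

lemma prism_prepend:
  assumes "starts_with y c"
  shows "frag_extend (prism p u) (prepend x c) = - prepend (u x) (prepend x c) -
    (if x \<in> interval p y \<and> u x \<noteq> u y then prepend (u x) (frag_extend (prism p u) c) else 0)"
  using assms
  by (induction c rule: frag_induction) (auto simp: frag_extend_diff algebra_simps)

lemma path_boundary_prepend2:
  assumes "starts_with z c"
  shows "frag_extend path_boundary (prepend x (prepend y c)) =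
    (if y \<in> interval x z then - prepend x c else 0) - prepend x (frag_extend path_boundary (prepend y c))"
  using assms
  by (induction c rule: frag_induction) (auto simp: frag_extend_diff algebra_simps)

lemma first_stepD:
  assumes "first_step p V u"
  shows "p \<in> M" "V \<subseteq> M"
    and "\<lbrakk>x \<in> V; x \<noteq> p\<rbrakk> \<Longrightarrow> u x \<in> interval p x" "\<lbrakk>x \<in> V; x \<noteq> p\<rbrakk> \<Longrightarrow> u x \<noteq> p"
      "\<lbrakk>x \<in> V; x \<noteq> p\<rbrakk> \<Longrightarrow> u x \<noteq> x" "\<lbrakk>x \<in> V; x \<noteq> p\<rbrakk> \<Longrightarrow> u x \<in> M"
    and "\<lbrakk>x \<in> V; y \<in> V; x \<noteq> p; x \<in> interval p y\<rbrakk> \<Longrightarrow> y \<noteq> p"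
    and "\<lbrakk>x \<in> V; y \<in> V; x \<noteq> p; x \<in> interval p y\<rbrakk> \<Longrightarrow> u x \<in> interval p (u y)"
    and "\<lbrakk>x \<in> V; y \<in> V; x \<noteq> p; x \<in> interval p y\<rbrakk> \<Longrightarrow> u y \<in> interval (u x) y"
    and "\<lbrakk>x \<in> V; y \<in> V; x \<noteq> p\<rbrakk> \<Longrightarrow> x \<in> interval (u x) y \<longleftrightarrow> x \<in> interval p y"
proof -
  show pV: "p \<in> M" "V \<subseteq> M"
    using assms by (auto simp: first_step_def)
  show u: "u x \<in> interval p x" "u x \<noteq> p" "u x \<noteq> x" "u x \<in> M" if "x \<in> V" "x \<noteq> p" for x
    using assms that interval_in_space[of "u x" p x] by (auto simp: first_step_def open_interval_def)
  show yp: "y \<noteq> p" if "x \<in> V" "y \<in> V" "x \<noteq> p" "x \<in> interval p y" for x y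
    using that interval_same pV by auto
  show mono: "u x \<in> interval p (u y)" if "x \<in> V" "y \<in> V" "x \<noteq> p" "x \<in> interval p y" for x y
    using that yp assms unfolding first_step_def by blast
  show "u y \<in> interval (u x) y" if "x \<in> V" "y \<in> V" "x \<noteq> p" "x \<in> interval p y" for x y
    using interval_nested(2)[of p y "u y" "u x"] mono yp u that pV by blast
  show "x \<in> interval (u x) y \<longleftrightarrow> x \<in> interval p y" if "x \<in> V" "y \<in> V" "x \<noteq> p" for x y
    using interval_nested(2)[of p y x "u x"] u that pV assms unfolding first_step_def by blast
qed

text \<open>Omitting \<open>u x\<^sub>i\<close> with \<open>i < j\<close>, or \<open>x\<^sub>i\<close> with \<open>i > j\<close>, from the \<open>j\<close>-th prism term amounts to omitting
  \<open>x\<^sub>i\<close> from the path first, with the opposite sign; and the \<open>j\<close>-th term without \<open>x\<^sub>j\<close> cancels the next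
  term without \<open>u x\<^sub>j\<^sub>+\<^sub>1\<close>. Two equal consecutive steps do no harm further on, because the term counted
  as \<open>0\<close> would have had two equal faces of opposite signs. If the first two steps are equal, one of
  these faces would omit the first vertex and does not occur, which leaves the last summand.\<close>

lemma prism_boundary:
  assumes "first_step p V u" "set (x # r) \<subseteq> V" "x \<noteq> p"
  shows "frag_extend path_boundary (prism p u (x # r)) + frag_extend (prism p u) (path_boundary (x # r)) +
    (case r of [] \<Rightarrow> 0 | y # s \<Rightarrow> if x \<in> interval p y \<and> u x = u y then prism p u r else 0) = 0"
  using assms(2,3)
proof (induction r arbitrary: x)
  case Nil
  then show ?case
    by (simp add: frag_extend_minus)
next
  case (Cons y s)
  note fs = first_stepD[OF assms(1)]
  have xy: "x \<in> V" "y \<in> V" "set s \<subseteq> V" "x \<noteq> p"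
    using Cons by auto
  have step_x: "x \<in> interval (u x) y \<longleftrightarrow> x \<in> interval p y"
    using fs xy by blast
  have IH: "frag_extend path_boundary (prism p u (y # s)) + frag_extend (prism p u) (path_boundary (y # s)) +
    (case s of [] \<Rightarrow> 0 | z # t \<Rightarrow> if y \<in> interval p z \<and> u y = u z then prism p u s else 0) = 0"
    if "x \<in> interval p y"
  proof -
    have "y \<noteq> p"
      using fs xy that by blast
    then show ?thesis
      using Cons.IH[of y] xy by simp
  qed
  show ?case
  proof (cases s)
    case Nil
    have "x \<in> interval p y \<Longrightarrow> u y \<in> interval (u x) y"
      using fs xy by blast
    then show ?thesis
      unfolding Nil using step_x by (auto simp: frag_extend_minus frag_extend_diff)
  next
    case (Cons z t)
    have z: "z \<in> V"
      using xy Cons by auto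
    let ?D = "frag_extend path_boundary" and ?T = "frag_extend (prism p u)"
    let ?ys = "y # z # t"
    have Dx: "path_boundary (x # ?ys) =
      (if y \<in> interval x z then - frag_of (x # z # t) else 0) - prepend x (path_boundary ?ys)"
      by simp
    have Dux: "path_boundary (u x # x # ?ys) =
      (if x \<in> interval p y then - frag_of (u x # ?ys) else 0) - prepend (u x) (path_boundary (x # ?ys))"
      by (subst path_boundary.simps(1)) (simp only: step_x)
    have DTx: "?D (prism p u (x # ?ys)) =
      (if x \<in> interval p y then frag_of (u x # ?ys) else 0) + prepend (u x) (path_boundary (x # ?ys)) -
      (if x \<in> interval p y \<and> u x \<noteq> u y then ?D (prepend (u x) (prism p u ?ys)) else 0)"
      unfolding prism.simps frag_extend_diff frag_extend_minus frag_extend_of Dux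
      by (auto simp del: path_boundary.simps prism.simps)
    have TDx: "?T (path_boundary (x # ?ys)) =
      (if y \<in> interval x z then frag_of (u x # x # z # t) +
        (if x \<in> interval p z \<and> u x \<noteq> u z then prepend (u x) (prism p u (z # t)) else 0) else 0) +
      prepend (u x) (prepend x (path_boundary ?ys)) +
      (if x \<in> interval p y \<and> u x \<noteq> u y then prepend (u x) (?T (path_boundary ?ys)) else 0)"
      unfolding Dx frag_extend_diff prism_prepend[OF path_boundary_starts_with]
      by (auto simp: frag_extend_minus algebra_simps simp del: path_boundary.simps)
    have xyz: "x \<in> interval p y" if "y \<in> interval x z" "x \<in> interval p z"
      using interval_nested(2)[of z p x y] that fs(1,2) xy z by (auto simp: interval_commute)
    have xyz': "y \<in> interval x z \<and> x \<in> interval p z \<longleftrightarrow> y \<in> interval p z" if "x \<in> interval p y"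
      using interval_nested[of p z y x] interval_nested(1)[of z p x y] that fs(1,2) xy z
      by (auto simp: interval_commute)
    show ?thesis
    proof (cases "x \<in> interval p y")
      case False
      then show ?thesis
        unfolding Cons using DTx TDx xyz Dx by (auto simp del: path_boundary.simps prism.simps)
    next
      case True
      have y: "y \<noteq> p"
        using fs xy True by blast
      show ?thesis
      proof (cases "u x = u y")
        case eq: True
        have "prism p u ?ys = - frag_of (u x # ?ys) -
            (if y \<in> interval p z \<and> u x \<noteq> u z then prepend (u x) (prism p u (z # t)) else 0)"
          using eq by simp
        then show ?thesis
          unfolding Cons using DTx TDx xyz' Dx True eq
          by (auto simp del: path_boundary.simps prism.simps)
      next
        case neq: False
        have uy: "u y \<in> interval (u x) y"
          using fs xy True by blast
        have uz: "u y \<in> interval (u x) (u z)" "u x \<noteq> u z" if "y \<in> interval p z"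
        proof -
          have "z \<noteq> p"
            using fs(7)[OF xy(2) z y that] .
          then have "u x \<in> interval p (u y)" "u y \<in> interval p (u z)" "u z \<in> M"
            using fs(8)[OF xy(1,2,4) True] fs(8)[OF xy(2) z y that] fs(6)[OF z] by auto
          then show "u y \<in> interval (u x) (u z)" "u x \<noteq> u z"
            using interval_nested(2)[of p "u z" "u y" "u x"] interval_antisym[of p "u x" "u y"] fs(1) neq
            by auto
        qed
        have "?D (prepend (u x) (prism p u ?ys)) = frag_of (u x # ?ys) +
          (if y \<in> interval p z \<and> u y \<noteq> u z then prepend (u x) (prism p u (z # t)) else 0) -
          prepend (u x) (?D (prism p u ?ys))"
          using uy uz path_boundary_prepend2[OF prism_starts_with[of p u z t], where x = "u x" and y = "u y"]
          by (auto simp: frag_extend_minus frag_extend_diff)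
        moreover have "prepend (u x) (?D (prism p u ?ys)) = - prepend (u x) (?T (path_boundary ?ys)) -
            (if y \<in> interval p z \<and> u y = u z then prepend (u x) (prism p u (z # t)) else 0)"
        proof -
          have "prepend (u x) (?D (prism p u ?ys) + ?T (path_boundary ?ys) +
            (if y \<in> interval p z \<and> u y = u z then prism p u (z # t) else 0)) = 0"
            using IH[OF True] unfolding Cons list.case by (simp only: prepend_simps(1))
          then have "prepend (u x) (?D (prism p u ?ys)) + prepend (u x) (?T (path_boundary ?ys)) +
            (if y \<in> interval p z \<and> u y = u z then prepend (u x) (prism p u (z # t)) else 0) = 0"
            by (simp only: prepend_simps(4) if_distrib[of "prepend (u x)"] prepend_simps(1))
          then show ?thesis
            by (simp only: eq_diff_eq eq_neg_iff_add_eq_0 ac_simps)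
        qed
        moreover have "?T (path_boundary (x # ?ys)) = (if y \<in> interval x z then frag_of (u x # x # z # t) else 0) +
          (if y \<in> interval p z then prepend (u x) (prism p u (z # t)) else 0) +
          prepend (u x) (prepend x (path_boundary ?ys)) + prepend (u x) (?T (path_boundary ?ys))"
          using TDx xyz'[OF True] uz(2) True neq by (auto simp del: path_boundary.simps prism.simps)
        moreover have "?D (prism p u (x # ?ys)) = frag_of (u x # ?ys) +
          prepend (u x) (path_boundary (x # ?ys)) - ?D (prepend (u x) (prism p u ?ys))"
          using DTx True neq by (simp del: path_boundary.simps prism.simps)
        moreover have "prepend (u x) (path_boundary (x # ?ys)) =
          (if y \<in> interval x z then - frag_of (u x # x # z # t) else 0) - prepend (u x) (prepend x (path_boundary ?ys))"
          by simp
        ultimately show ?thesis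
          unfolding Cons using neq by (simp del: path_boundary.simps prism.simps)
      qed
    qed
  qed
qed

text \<open>After \<open>p\<close> is put in front, one more vertex becomes removable, the first step \<open>u x\<close>. Removing it
  from the first prism term returns the original path, and from the other terms it cancels the
  contribution of the face without \<open>x\<close>. The second and third summands come from contracting the face
  of \<open>p # x # r\<close> without \<open>x\<close> and the other faces.\<close>

lemma prism_homotopy_from:
  assumes "first_step p V u" "set (x # r) \<subseteq> V" "x \<noteq> p"
  shows "frag_extend path_boundary (prepend p (prism p u (x # r))) +
    (case r of [] \<Rightarrow> 0 | y # s \<Rightarrow> if x \<in> interval p y then - prepend p (prism p u r) else 0) -
    prepend p (frag_extend (prism p u) (path_boundary (x # r))) = frag_of (p # x # r)"
proof -
  note fs = first_stepD[OF assms(1)]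
  have x: "x \<in> V"
    using assms by auto
  have ux: "u x \<in> interval p x"
    using fs x assms(3) by blast
  show ?thesis
  proof (cases r)
    case Nil
    then show ?thesis
      using ux by (simp add: frag_extend_minus)
  next
    case (Cons y s)
    let ?D = "frag_extend path_boundary" and ?T = "frag_extend (prism p u)"
    let ?ys = "y # s"
    have y: "y \<in> V"
      using assms Cons by auto
    have uy: "u x \<in> interval p (u y)" if "x \<in> interval p y"
      using fs(8)[OF x y assms(3) that] .
    have "path_boundary (p # u x # x # ?ys) = - frag_of (p # x # ?ys) - prepend p (path_boundary (u x # x # ?ys))"
      using ux by simp
    then have "?D (prepend p (prism p u (x # ?ys))) =
      frag_of (p # x # ?ys) + prepend p (path_boundary (u x # x # ?ys)) -
      (if x \<in> interval p y \<and> u x \<noteq> u y then ?D (prepend p (prepend (u x) (prism p u ?ys))) else 0)"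
      by (simp add: frag_extend_minus frag_extend_diff del: path_boundary.simps)
    moreover have "?D (prepend p (prepend (u x) (prism p u ?ys))) =
      - prepend p (prism p u ?ys) - prepend p (?D (prepend (u x) (prism p u ?ys)))" if "x \<in> interval p y"
      using path_boundary_prepend2[OF prism_starts_with[of p u y s], where x = p and y = "u x"] uy[OF that]
      by simp
    moreover have "prepend p (?D (prism p u (x # ?ys))) = - prepend p (path_boundary (u x # x # ?ys)) -
      (if x \<in> interval p y \<and> u x \<noteq> u y then prepend p (?D (prepend (u x) (prism p u ?ys))) else 0)"
      by (simp add: frag_extend_minus frag_extend_diff del: path_boundary.simps)
    moreover have "prepend p (?T (path_boundary (x # ?ys))) = - prepend p (?D (prism p u (x # ?ys))) -
      (if x \<in> interval p y \<and> u x = u y then prepend p (prism p u ?ys) else 0)"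
    proof -
      have "prepend p (?D (prism p u (x # ?ys)) + ?T (path_boundary (x # ?ys)) +
        (if x \<in> interval p y \<and> u x = u y then prism p u ?ys else 0)) = 0"
        using prism_boundary[OF assms] unfolding Cons list.case by (simp only: prepend_simps(1))
      then have "prepend p (?D (prism p u (x # ?ys))) + prepend p (?T (path_boundary (x # ?ys))) +
        (if x \<in> interval p y \<and> u x = u y then prepend p (prism p u ?ys) else 0) = 0"
        by (simp only: prepend_simps(4) if_distrib[of "prepend p"] prepend_simps(1))
      then show ?thesis
        by (simp only: eq_diff_eq eq_neg_iff_add_eq_0 ac_simps)
    qed
    ultimately show ?thesis
      unfolding Cons by (simp del: path_boundary.simps prism.simps)
  qed
qed

definition contraction :: "('a \<Rightarrow> 'a \<Rightarrow> 'a) \<Rightarrow> ('a list \<Rightarrow>\<^sub>0 int) \<Rightarrow> ('a list \<Rightarrow>\<^sub>0 int)"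
  where "contraction u = frag_extend (\<lambda>xs. prepend (hd xs) (prism (hd xs) (u (hd xs)) (tl xs)))"

lemma contraction_diff: "contraction u (a - b) = contraction u a - contraction u b"
  by (simp add: contraction_def frag_extend_diff)

lemma contraction_prepend: "contraction u (prepend p c) = prepend p (frag_extend (prism p (u p)) c)"
proof -
  have "Poly_Mapping.keys c \<subseteq> UNIV"
    by simp
  then show ?thesis
    by (induction c rule: frag_induction) (auto simp: contraction_def frag_extend_diff)
qed

lemma contraction_identity:
  assumes "first_step p V (u p)" "set (x # r) \<subseteq> V" "x \<noteq> p"
  shows "frag_extend path_boundary (contraction u (frag_of (p # x # r))) +
    contraction u (path_boundary (p # x # r)) = frag_of (p # x # r)"
proof -
  have "contraction u (path_boundary (p # x # r)) =
    (case r of [] \<Rightarrow> 0 | y # s \<Rightarrow> if x \<in> interval p y then - prepend p (prism p (u p) r) else 0) -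
    prepend p (frag_extend (prism p (u p)) (path_boundary (x # r)))"
  proof (cases r)
    case Nil
    then show ?thesis
      by (simp add: contraction_def)
  next
    case (Cons y s)
    have "contraction u (path_boundary (p # x # y # s)) =
      contraction u (if x \<in> interval p y then - frag_of (p # y # s) else 0) -
      contraction u (prepend p (path_boundary (x # y # s)))"
      by (simp only: path_boundary.simps(1) contraction_diff)
    then show ?thesis
      unfolding contraction_prepend Cons
      by (simp add: contraction_def frag_extend_minus del: path_boundary.simps)
  qed
  moreover have "contraction u (frag_of (p # x # r)) = prepend p (prism p (u p) (x # r))"
    by (simp add: contraction_def)
  ultimately show ?thesis
    using prism_homotopy_from[OF assms] by (simp only: add_diff_eq)
qed

end

section \<open>First steps exist in Menger convex median spaces\<close>

context median_space
begin

text \<open>The meets of subsets of \<open>V\<close> suffice, and each subset has at most one.\<close>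

lemma finite_meet_closure:
  assumes "finite V" "V \<subseteq> M" "p \<in> M"
  obtains F where "finite F" "V \<subseteq> F" "F \<subseteq> M" "\<And>x y. \<lbrakk>x \<in> F; y \<in> F\<rbrakk> \<Longrightarrow> med p x y \<in> F"
proof -
  define glb where "glb S z \<longleftrightarrow> z \<in> M \<and> (\<forall>s\<in>S. z \<in> interval p s) \<and>
    (\<forall>w\<in>M. (\<forall>s\<in>S. w \<in> interval p s) \<longrightarrow> w \<in> interval p z)" for S z
  define F where "F = {z. \<exists>S\<subseteq>V. glb S z}"
  have unique: "y = z" if "glb S y" "glb S z" for S y z
    using that interval_antisym[of p y z] assms(3) unfolding glb_def by simp
  have "F \<subseteq> (\<lambda>S. THE z. glb S z) ` Pow V"
  proof
    fix z assume "z \<in> F"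
    then obtain S where S: "S \<subseteq> V" "glb S z"
      by (auto simp: F_def)
    then have "(THE z. glb S z) = z"
      using unique by blast
    then show "z \<in> (\<lambda>S. THE z. glb S z) ` Pow V"
      using S(1) by (intro image_eqI[of _ _ S]) auto
  qed
  then have "finite F"
    by (rule finite_surj[rotated]) (use assms(1) in simp)
  moreover have "V \<subseteq> F"
  proof
    fix x assume "x \<in> V"
    then have "{x} \<subseteq> V" "glb {x} x"
      using assms interval_endpoints[of p x] by (auto simp: glb_def)
    then show "x \<in> F"
      unfolding F_def by blast
  qed
  moreover have "F \<subseteq> M"
    by (auto simp: F_def glb_def)
  moreover have "med p x y \<in> F" if xy: "x \<in> F" "y \<in> F" for x y
  proof -
    obtain S R where SR: "S \<subseteq> V" "glb S x" "R \<subseteq> V" "glb R y"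
      using xy unfolding F_def by blast
    then have M: "x \<in> M" "y \<in> M"
      by (auto simp: glb_def)
    have "med p x y \<in> interval p s" if s: "s \<in> S \<union> R" for s
    proof -
      have "x \<in> interval p s \<or> y \<in> interval p s"
        using s SR by (auto simp: glb_def)
      then show ?thesis
        using med_between[of p x y] interval_nested(1)[of p s x] interval_nested(1)[of p s y]
          assms(2,3) M s SR by blast
    qed
    then have "glb (S \<union> R) (med p x y)"
      using SR M med_in_space med_greatest assms(3) unfolding glb_def by auto
    then show ?thesis
      unfolding F_def using SR by blast
  qed
  ultimately show ?thesis
    using that by blast
qed

text \<open>This is what betweenness of \<open>x\<close> means in the order based at \<open>p\<close>: the join of \<open>u\<close> with the
  projection of \<open>y\<close> to \<open>interval p x\<close> lies on a shortest path from \<open>u\<close> to \<open>x\<close> as well as on one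
  from \<open>x\<close> to \<open>y\<close>. If the two paths compose to a shortest path, this point can only be \<open>x\<close>.\<close>

lemma lub_of_shadow:
  assumes "x \<in> M" "y \<in> M" "p \<in> M" "u \<in> interval p x" "x \<in> interval u y"
  shows "is_lub p {u, med p x y} x"
proof -
  define m where "m = med p x y"
  have m: "m \<in> interval p x" "m \<in> interval x y" "m \<in> M" "u \<in> M"
    using med_between[of p x y] assms interval_in_space unfolding m_def by auto
  have l: "is_lub p {u, m} (med x u m)"
    using med_is_lub assms m by blast
  define j where "j = med x u m"
  have j: "j \<in> interval u x" "j \<in> interval x m" "j \<in> M"
    using med_between[of x u m] assms m interval_in_space unfolding j_def by (auto simp: interval_commute)
  have "j \<in> interval x y"
    using interval_nested(1)[of x y m j] assms m j by auto
  then have "d x y = d x j + d j y"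
    by (simp add: interval_def)
  moreover have "d u y = d u x + d x y" "d u x = d u j + d j x"
    using j assms by (auto simp: interval_def)
  moreover have "d u y \<le> d u j + d j y"
    using triangle j m assms by blast
  ultimately have "d j x = 0"
    using nonneg[of j x] commute[of j x] by linarith
  then have "j = x"
    using j assms by simp
  then show ?thesis
    using l unfolding j_def m_def by simp
qed

text \<open>Close \<open>V\<close> under meets to obtain a finite set \<open>F\<close>, and use Menger convexity to choose a point \<open>b a\<close>
  strictly between \<open>p\<close> and each atom \<open>a\<close> of \<open>F\<close>. The step \<open>u x\<close> is the join of the \<open>b a\<close> over the
  atoms \<open>a\<close> below \<open>x\<close>. In a cube complex this would be the centre of the cube at \<open>p\<close> spanned by the
  edges that lead towards \<open>x\<close>. Since distinct atoms meet in \<open>p\<close>, distributivity shows that a join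
  of points \<open>b c\<close> and of elements of \<open>F\<close> is above an atom \<open>a\<close> only if one of these elements of \<open>F\<close>
  is above \<open>a\<close>.\<close>

lemma first_step_exists:
  assumes convex: Menger_convex and V: "finite V" "V \<subseteq> M" and p: "p \<in> M"
  obtains u where "first_step p V u"
proof -
  obtain F where F: "finite F" "V \<subseteq> F" "F \<subseteq> M" "\<And>x y. \<lbrakk>x \<in> F; y \<in> F\<rbrakk> \<Longrightarrow> med p x y \<in> F"
    using finite_meet_closure V p by blast
  define A where "A = {a \<in> F. a \<noteq> p \<and> (\<forall>z\<in>F. z \<in> interval p a \<longrightarrow> z = p \<or> z = a)}"
  have A: "finite A" "A \<subseteq> M"
    using F by (auto simp: A_def)
  have atom: "z = p \<or> z = a" if "a \<in> A" "z \<in> F" "z \<in> interval p a" for a z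
    using that by (simp add: A_def)
  have atom_below: "\<exists>a\<in>A. a \<in> interval p x" if x: "x \<in> F" "x \<noteq> p" for x
  proof -
    define B where "B = {z \<in> F. z \<noteq> p \<and> z \<in> interval p x}"
    have "finite B" "x \<in> B"
      using F x p interval_endpoints[of p x] by (auto simp: B_def)
    then obtain a where a: "a \<in> B" "\<And>z. z \<in> B \<Longrightarrow> d p a \<le> d p z"
      using arg_min_if_finite[of B "d p"] by (metis empty_iff linorder_not_le)
    have "z = p \<or> z = a" if z: "z \<in> F" "z \<in> interval p a" for z
    proof (rule disjCI)
      assume "z \<noteq> a"
      show "z = p"
      proof (rule ccontr)
        assume "z \<noteq> p"
        have "x \<in> M"
          using x F by auto
        then have "z \<in> B"
          using z a \<open>z \<noteq> p\<close> interval_nested(1)[of p x a z] p by (auto simp: B_def)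
        then have "d p a \<le> d p z"
          using a by blast
        then have "d z a = 0"
          using z nonneg[of z a] unfolding interval_def by (smt (verit) mem_Collect_eq)
        then show False
          using \<open>z \<noteq> a\<close> zero[of z a] z a(1) F(3) by (auto simp: B_def)
      qed
    qed
    then have "a \<in> A"
      using a(1) by (simp add: A_def B_def)
    then show ?thesis
      using a(1) by (auto simp: B_def)
  qed
  define b where "b a = (SOME z. z \<in> open_interval p a)" for a
  have b: "b a \<in> interval p a" "b a \<noteq> p" "b a \<noteq> a" if "a \<in> A" for a
  proof -
    have "a \<in> M" "a \<noteq> p"
      using that F by (auto simp: A_def)
    then have "open_interval p a \<noteq> {}"
      using convex p by (auto simp: Menger_convex_def)
    then have "b a \<in> open_interval p a"
      unfolding b_def by (simp add: some_in_eq)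
    then show "b a \<in> interval p a" "b a \<noteq> p" "b a \<noteq> a"
      by (auto simp: open_interval_def)
  qed
  have bM: "b a \<in> M" if "a \<in> A" for a
    using that b interval_in_space by blast
  define u where "u x = (SOME z. is_lub p (b ` {a \<in> A. a \<in> interval p x}) z)" for x
  have bx: "b a \<in> interval p x" if "a \<in> A" "a \<in> interval p x" "x \<in> M" for a x
    using that b(1) interval_nested(1) p by blast
  have u: "is_lub p (b ` {a \<in> A. a \<in> interval p x}) (u x)" if x: "x \<in> M" for x
  proof -
    have "\<exists>z. is_lub p (b ` {a \<in> A. a \<in> interval p x}) z"
    proof (rule is_lub_exists[OF _ p x])
      show "s \<in> interval p x" if "s \<in> b ` {a \<in> A. a \<in> interval p x}" for s
        using that bx x by blast
    qed (use A in simp)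
    then show ?thesis
      unfolding u_def by (rule someI_ex)
  qed
  have u_below: "u x \<in> interval p x" if "x \<in> M" for x
  proof -
    have "\<forall>s \<in> b ` {a \<in> A. a \<in> interval p x}. s \<in> interval p x"
      using bx that by blast
    then show ?thesis
      using u[OF that] that unfolding is_lub_def by blast
  qed
  have meet_b: "med p a (b c) \<in> interval p (b a)" if "a \<in> A" "c \<in> A" for a c
  proof -
    have M: "a \<in> M" "c \<in> M" "b a \<in> M" "b c \<in> M"
      using that A bM by auto
    have le: "med p a (b c) \<in> interval p a" "med p a (b c) \<in> interval p (b c)"
      using med_between p M by auto
    show ?thesis
    proof (cases "a = c")
      case True
      then show ?thesis
        using le by simp
    next
      case False
      have "med p a c \<in> F" "med p a c \<in> interval p a" "med p a c \<in> interval p c"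
        using that F med_between[of p a c] p M by (auto simp: A_def)
      then have "med p a c = p"
        using that False atom[of a "med p a c"] atom[of c "med p a c"] by auto
      moreover have "med p a (b c) \<in> interval p (med p a c)"
        using le b that interval_nested(1)[of p c "b c" "med p a (b c)"] med_greatest p M by blast
      ultimately have "med p a (b c) = p"
        using interval_same p by simp
      then show ?thesis
        using interval_endpoints p M by simp
    qed
  qed
  \<comment> \<open>If \<open>B\<close> has join \<open>z\<close> and all its elements meet the atom \<open>a\<close> below \<open>b a\<close>, then so does \<open>z\<close>, which
    excludes \<open>a \<le> z\<close> because \<open>b a\<close> is strictly below \<open>a\<close>.\<close>
  have not_below: "\<not> a \<in> interval p z"
    if a: "a \<in> A" and B: "finite B" "is_lub p B z"
      "\<And>s. s \<in> B \<Longrightarrow> med p a s \<in> interval p (b a)" for a z B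
  proof
    assume az: "a \<in> interval p z"
    have M: "a \<in> M" "b a \<in> M" "z \<in> M"
      using a A bM B by (auto simp: is_lub_def)
    have "med p a z \<in> interval p (b a)"
      using med_lub_le[of B p a "b a" z] B p M by blast
    moreover have "a \<in> interval p (med p a z)"
      using med_greatest[of p a z a] interval_endpoints[of p a] az p M by blast
    ultimately have "a \<in> interval p (b a)"
      using interval_nested(1) p M by blast
    then show False
      using b[OF a] interval_antisym p by blast
  qed
  have step1: "u x \<in> open_interval p x" if x: "x \<in> V - {p}" for x
  proof -
    have xM: "x \<in> M" "x \<in> F" "x \<noteq> p"
      using x V F by auto
    then obtain a where a: "a \<in> A" "a \<in> interval p x"
      using atom_below by blast
    have "b a \<in> interval p (u x)"
      using a u xM by (auto simp: is_lub_def)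
    then have "u x \<noteq> p"
      using b[OF a(1)] interval_same[OF p] by auto
    moreover have "\<not> a \<in> interval p (u x)"
      by (rule not_below[OF a(1) _ u[OF xM(1)]]) (use A meet_b a in auto)
    then have "u x \<noteq> x"
      using a by auto
    ultimately show ?thesis
      using u_below xM by (auto simp: open_interval_def)
  qed
  have step2: "u x \<in> interval p (u y)"
    if xy: "x \<in> V - {p}" "y \<in> V - {p}" "x \<in> interval p y" for x y
  proof -
    have M: "x \<in> M" "y \<in> M"
      using xy V by auto
    have "b a \<in> interval p (u y)" if "a \<in> A" "a \<in> interval p x" for a
    proof -
      have "a \<in> interval p y"
        using interval_nested(1)[of p y x a] that xy M p by auto
      then show ?thesis
        using u[OF M(2)] that by (auto simp: is_lub_def)
    qed
    then show ?thesis
      using u[OF M(1)] u[OF M(2)] by (auto simp: is_lub_def)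
  qed
  have step3: "x \<in> interval p y" if xy: "x \<in> V - {p}" "y \<in> V" "x \<in> interval (u x) y" for x y
  proof -
    have M: "x \<in> M" "y \<in> M" "x \<in> F" "y \<in> F" "u x \<in> M"
      using xy V F interval_in_space[OF u_below] by auto
    define m where "m = med p x y"
    have m: "m \<in> F" "m \<in> M" "m \<in> interval p x" "m \<in> interval p y"
      using F M med_between[of p x y] p unfolding m_def by auto
  \<comment> \<open>It remains to see \<open>u x \<le> m\<close>, for then this join is \<open>m\<close>. An atom below \<open>x\<close> but not below \<open>m\<close>
      meets \<open>m\<close> in \<open>p\<close>, and so cannot be below the join of \<open>u x\<close> and \<open>m\<close>.\<close>
    have lub: "is_lub p {u x, m} x"
      unfolding m_def using lub_of_shadow M p u_below xy by blast
    have below_m: "a \<in> interval p m" if a: "a \<in> A" "a \<in> interval p x" for a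
    proof (rule ccontr)
      assume not: "a \<notin> interval p m"
      have aM: "a \<in> M" "b a \<in> M" "a \<in> F"
        using a(1) A bM unfolding A_def by auto
      have "med p a m \<in> F" "med p a m \<in> interval p a" "med p a m \<in> interval p m"
        using F m aM med_between[of p a m] p by auto
      then have "med p a m = p"
        using a not atom[of a "med p a m"] by auto
      then have "med p a m \<in> interval p (b a)"
        using interval_endpoints p aM by simp
      moreover have "med p a (u x) \<in> interval p (b a)"
        by (rule med_lub_le[OF _ p aM(1,2) u[OF M(1)]]) (use A meet_b a in auto)
      ultimately have "\<not> a \<in> interval p x"
        by (intro not_below[OF a(1) _ lub]) auto
      then show False
        using a by simp
    qed
    have "u x \<in> interval p m"
      using u[OF M(1)] m bx below_m by (auto simp: is_lub_def)
    then have "x \<in> interval p m"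
      using lub m interval_endpoints[OF p m(2)] by (auto simp: is_lub_def)
    then have "x = m"
      using m interval_antisym p by blast
    then show ?thesis
      using m by simp
  qed
  have "first_step p V u"
    unfolding first_step_def using p V step1 step2 step3 by blast
  then show ?thesis
    using that by blast
qed

end

section \<open>Vanishing of magnitude homology\<close>

context Metric_space
begin

lemma paths_eq: "paths k = {xs. length xs = Suc k \<and> set xs \<subseteq> M \<and> distinct_adj xs}"
  by (auto simp: paths_def distinct_adj_conv_nth)

lemma keys_prism:
  assumes "first_step p V u" "set (x # r) \<subseteq> V" "x \<noteq> p" "distinct_adj (x # r)"
    and "xs \<in> Poly_Mapping.keys (prism p u (x # r))"
  shows "length xs = length r + 2 \<and> set xs \<subseteq> M \<and> distinct_adj xs \<and> hd xs = u x"
  using assms(2-)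
proof (induction r arbitrary: x xs)
  case Nil
  then have "x \<in> V" "x \<noteq> p" "xs = [u x, x]"
    by auto
  then show ?case
    using first_stepD(2,5,6)[OF assms(1)] by auto
next
  case (Cons y s)
  note fs = first_stepD[OF assms(1)]
  have x: "x \<in> V" "y \<in> V" "x \<noteq> p" "set (y # s) \<subseteq> V" "distinct_adj (y # s)" "x \<noteq> y"
    using Cons by auto
  have ux: "u x \<in> M" "u x \<noteq> x"
    using fs(5,6) x by blast+
  have "xs = u x # x # y # s \<or>
    (x \<in> interval p y \<and> u x \<noteq> u y \<and> xs \<in> Poly_Mapping.keys (prepend (u x) (prism p u (y # s))))"
    using Cons.prems(4) keys_diff[of "- frag_of (u x # x # y # s)"
        "if x \<in> interval p y \<and> u x \<noteq> u y then prepend (u x) (prism p u (y # s)) else 0"]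
    by (auto split: if_splits)
  then show ?case
  proof
    assume "xs = u x # x # y # s"
    then show ?thesis
      using ux x fs(2) by auto
  next
    assume *: "x \<in> interval p y \<and> u x \<noteq> u y \<and> xs \<in> Poly_Mapping.keys (prepend (u x) (prism p u (y # s)))"
    then have "xs \<in> Poly_Mapping.keys (prepend (u x) (prism p u (y # s)))"
      by simp
    then have "xs \<in> (#) (u x) ` Poly_Mapping.keys (prism p u (y # s))"
      by (rule subsetD[OF keys_prepend])
    then obtain zs where zs: "xs = u x # zs" "zs \<in> Poly_Mapping.keys (prism p u (y # s))"
      by blast
    have "y \<noteq> p"
      using fs(7) x * by blast
    then have "length zs = length s + 2 \<and> set zs \<subseteq> M \<and> distinct_adj zs \<and> hd zs = u y"
      using Cons.IH[of y zs] x zs(2) by blast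
    then show ?thesis
      using zs * ux by (auto simp: distinct_adj_Cons)
  qed
qed

lemma path_face_Suc:
  assumes "1 \<le> i"
  shows "path_face (Suc i) (x # xs) = prepend x (path_face i xs)"
proof -
  obtain j where "i = Suc j"
    using assms by (cases i) auto
  then show ?thesis
    by (simp add: path_face_def)
qed

lemma sum_path_faces:
  "(\<Sum>i = 1..<length xs - 1. frag_cmul ((-1) ^ i) (path_face i xs)) = path_boundary xs"
proof (induction xs rule: path_boundary.induct)
  case (1 x y z r)
  have pre_cmul: "prepend x (frag_cmul c a) = frag_cmul c (prepend x a)" for c a
    by (simp add: prepend_def frag_extend_cmul)
  have pre_sum: "prepend x (\<Sum>i\<in>I. f i) = (\<Sum>i\<in>I. prepend x (f i))" if "finite I" for I :: "nat set" and f
    using that by (simp add: prepend_def frag_extend_sum)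
  let ?n = "length (y # z # r) - 1"
  have "(\<Sum>i = 1..<length (x # y # z # r) - 1. frag_cmul ((-1) ^ i) (path_face i (x # y # z # r))) =
    frag_cmul ((-1) ^ 1) (path_face 1 (x # y # z # r)) +
    (\<Sum>i = Suc 1..<Suc ?n. frag_cmul ((-1) ^ i) (path_face i (x # y # z # r)))"
    by (subst sum.atLeast_Suc_lessThan) auto
  also have "(\<Sum>i = Suc 1..<Suc ?n. frag_cmul ((-1) ^ i) (path_face i (x # y # z # r))) =
    (\<Sum>i = 1..<?n. frag_cmul ((-1) ^ Suc i) (path_face (Suc i) (x # y # z # r)))"
    by (rule sum.shift_bounds_Suc_ivl)
  also have "\<dots> = (\<Sum>i = 1..<?n. - prepend x (frag_cmul ((-1) ^ i) (path_face i (y # z # r))))"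
    by (rule sum.cong) (simp_all add: path_face_Suc pre_cmul)
  also have "\<dots> = - prepend x (path_boundary (y # z # r))"
    by (simp only: sum_negf pre_sum[OF finite_atLeastLessThan, symmetric] 1)
  also have "frag_cmul ((-1) ^ 1) (path_face 1 (x # y # z # r)) =
    (if y \<in> interval x z then - frag_of (x # z # r) else 0)"
    by (simp add: path_face_def)
  finally show ?case
    by simp
qed auto

lemma magnitude_boundary_eq:
  assumes "c \<in> carrier (magnitude_chain_group k)"
  shows "magnitude_boundary k c = frag_extend path_boundary c"
  unfolding magnitude_boundary_def
proof (rule frag_extend_eq)
  fix xs assume "xs \<in> Poly_Mapping.keys c"
  then have "length xs = Suc k"
    using assms by (auto simp: magnitude_chain_group_def paths_def)
  then show "(\<Sum>i = 1..<k. frag_cmul ((-1) ^ i) (path_face i xs)) = path_boundary xs"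
    using sum_path_faces[of xs] by simp
qed

text \<open>A cycle involves finitely many points, so first steps with respect to this finite set, one
  function for each starting vertex, contract it.\<close>

lemma cycle_is_boundary:
  assumes steps: "\<And>V p. \<lbrakk>finite V; V \<subseteq> M; p \<in> M\<rbrakk> \<Longrightarrow> \<exists>u. first_step p V u"
    and "k \<ge> 1" and c: "c \<in> magnitude_cycles k"
  shows "c \<in> magnitude_boundaries k"
proof -
  have chain: "c \<in> carrier (magnitude_chain_group k)" and "magnitude_boundary k c = 0"
    using c by (auto simp: magnitude_cycles_def kernel_def magnitude_chain_group_def)
  then have cycle: "frag_extend path_boundary c = 0"
    by (simp add: magnitude_boundary_eq)
  have paths: "length xs = Suc k" "set xs \<subseteq> M" "distinct_adj xs" if "xs \<in> Poly_Mapping.keys c" for xs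
    using chain that by (auto simp: magnitude_chain_group_def paths_eq)
  define V where "V = (\<Union>xs\<in>Poly_Mapping.keys c. set xs)"
  have V: "finite V" "V \<subseteq> M"
    using paths by (auto simp: V_def)
  then obtain u where u: "first_step p V (u p)" if "p \<in> M" for p
    using steps by metis
  have decomp: "\<exists>p x r. xs = p # x # r \<and> p \<in> M \<and> set (x # r) \<subseteq> V \<and> x \<noteq> p \<and> distinct_adj (x # r) \<and> length r = k - 1"
    if xs: "xs \<in> Poly_Mapping.keys c" for xs
  proof -
    obtain p x r where "xs = p # x # r"
      using paths(1)[OF xs] assms(2) by (cases xs; cases "tl xs") auto
    moreover have "set xs \<subseteq> V"
      using xs by (auto simp: V_def)
    ultimately show ?thesis
      using paths[OF xs] assms(2) by auto
  qed
  define b where "b = contraction u c"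
  have "b \<in> carrier (magnitude_chain_group (Suc k))"
  proof -
    have "ys \<in> paths (Suc k)" if ys: "ys \<in> Poly_Mapping.keys b" for ys
    proof -
      obtain xs where xs: "xs \<in> Poly_Mapping.keys c"
        "ys \<in> Poly_Mapping.keys (prepend (hd xs) (prism (hd xs) (u (hd xs)) (tl xs)))"
        using subsetD[OF keys_frag_extend ys[unfolded b_def contraction_def]] by (auto simp del: prism.simps)
      obtain p x r where pxr: "xs = p # x # r" "p \<in> M" "set (x # r) \<subseteq> V" "x \<noteq> p" "distinct_adj (x # r)" "length r = k - 1"
        using decomp[OF xs(1)] by blast
      have "ys \<in> (#) p ` Poly_Mapping.keys (prism p (u p) (x # r))"
        using xs(2) unfolding pxr(1) list.sel by (rule subsetD[OF keys_prepend])
      then obtain zs where zs: "ys = p # zs" "zs \<in> Poly_Mapping.keys (prism p (u p) (x # r))"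
        by blast
      have "length zs = length r + 2 \<and> set zs \<subseteq> M \<and> distinct_adj zs \<and> hd zs = u p x"
        using keys_prism[OF u[OF pxr(2)] pxr(3,4,5) zs(2)] .
      moreover have "u p x \<noteq> p"
        using first_stepD(4)[OF u[OF pxr(2)], of x] pxr(3,4) by simp
      ultimately show ?thesis
        using zs(1) pxr assms(2) by (auto simp: paths_eq distinct_adj_Cons)
    qed
    then show ?thesis
      by (auto simp: magnitude_chain_group_def)
  qed
  moreover have "frag_extend path_boundary b = c"
  proof -
    have "frag_extend path_boundary (contraction u a) + contraction u (frag_extend path_boundary a) = a"
      if "Poly_Mapping.keys a \<subseteq> Poly_Mapping.keys c" for a
      using that
    proof (induction a rule: frag_induction)
      case (one xs)
      then obtain p x r where pxr: "xs = p # x # r" "p \<in> M" "set (x # r) \<subseteq> V" "x \<noteq> p"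
        using decomp by blast
      then show ?case
        using contraction_identity[where u = u, OF u[OF pxr(2)] pxr(3,4)] by (simp only: frag_extend_of)
    next
      case (diff a b)
      then show ?case
        by (simp add: contraction_def frag_extend_diff algebra_simps)
    qed (simp add: contraction_def)
    then show ?thesis
      using cycle unfolding b_def by (metis add.right_neutral frag_extend_0 contraction_def subset_refl)
  qed
  ultimately show ?thesis
    unfolding magnitude_boundaries_def using magnitude_boundary_eq by (metis image_eqI)
qed

end

lemma (in group) trivial_group_Mod_subgroup_generated:
  assumes N: "subgroup N G" and S: "S \<subseteq> N"
  shows "trivial_group (subgroup_generated G S Mod N)"
proof -
  have "carrier (subgroup_generated G S) \<subseteq> N"
    using subgroup_generated_minimal[OF N S] .
  moreover have "\<one> \<in> carrier (subgroup_generated G S)"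
    using group.is_monoid[OF group_subgroup_generated] monoid.one_closed by fastforce
  moreover have "N #>\<^bsub>subgroup_generated G S\<^esub> x = N" if "x \<in> N" for x
    using coset_join2[OF _ N that] subgroup.mem_carrier[OF N that] by (simp add: r_coset_def)
  ultimately have carr: "carrier (subgroup_generated G S Mod N) = {N}"
    by (auto simp: FactGroup_def RCOSETS_def)
  have mult: "N <#>\<^bsub>subgroup_generated G S\<^esub> N = N"
    using subgroup_mult_id[OF N] by (simp add: set_mult_def)
  have one: "\<one>\<^bsub>subgroup_generated G S Mod N\<^esub> = N"
    by (simp add: FactGroup_def)
  have "group (subgroup_generated G S Mod N)"
    by (rule groupI) (auto simp: carr mult one)
  then show ?thesis
    using carr one by (simp add: trivial_group_def)
qed

lemma (in Metric_space) trivial_magnitude_homology: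
  assumes "magnitude_cycles k \<subseteq> magnitude_boundaries k"
    and "magnitude_boundaries k \<subseteq> carrier (magnitude_chain_group k)"
  shows "trivial_group (magnitude_homology k)"
proof -
  have G: "group (magnitude_chain_group j)" for j
    by (simp add: magnitude_chain_group_def)
  show ?thesis
    unfolding magnitude_homology_def
  proof (rule group.trivial_group_Mod_subgroup_generated[OF G _ assms(1)])
    have "magnitude_boundary (Suc k) \<in> hom (magnitude_chain_group (Suc k)) (magnitude_chain_group k)"
      using assms(2)
      by (auto simp: hom_def magnitude_boundaries_def magnitude_boundary_def magnitude_chain_group_def frag_extend_add)
    then show "subgroup (magnitude_boundaries k) (magnitude_chain_group k)"
      unfolding magnitude_boundaries_def
      by (intro group_hom.img_is_subgroup) (simp add: group_hom_def group_hom_axioms_def G)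
  qed
qed

lemma (in Metric_space) magnitude_boundaries_subset:
  "magnitude_boundaries k \<subseteq> carrier (magnitude_chain_group k)"
proof -
  have face: "Poly_Mapping.keys (path_boundary xs) \<subseteq> {ys. Suc (length ys) = length xs \<and> set ys \<subseteq> set xs \<and> distinct_adj ys}"
    if "distinct_adj xs" "set xs \<subseteq> M" for xs
    using that
  proof (induction xs rule: path_boundary.induct)
    case (1 x y z r)
    have "Suc (length ys) = length (x # y # z # r) \<and> set ys \<subseteq> set (x # y # z # r) \<and> distinct_adj ys"
      if ys: "ys \<in> Poly_Mapping.keys (path_boundary (x # y # z # r))" for ys
    proof -
      have "(y \<in> interval x z \<and> ys = x # z # r) \<or>
          ys \<in> Poly_Mapping.keys (prepend x (path_boundary (y # z # r)))"
        using ys keys_diff[of "if y \<in> interval x z then - frag_of (x # z # r) else 0"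
            "prepend x (path_boundary (y # z # r))"]
        by (auto split: if_splits)
      then show ?thesis
      proof
        assume *: "y \<in> interval x z \<and> ys = x # z # r"
        \<comment> \<open>only \<open>x\<close> itself is between \<open>x\<close> and \<open>x\<close>, and \<open>y\<close> differs from \<open>x\<close>\<close>
        have "x \<noteq> z"
          using interval_same[of x y] * 1(2,3) by auto
        then show ?thesis
          using * 1(2) by (auto simp: distinct_adj_Cons)
      next
        assume "ys \<in> Poly_Mapping.keys (prepend x (path_boundary (y # z # r)))"
        then have "ys \<in> (#) x ` Poly_Mapping.keys (path_boundary (y # z # r))"
          by (rule subsetD[OF keys_prepend])
        then obtain zs where zs: "ys = x # zs" "zs \<in> Poly_Mapping.keys (path_boundary (y # z # r))"
          by (auto simp del: path_boundary.simps)
        from zs(2) have "zs \<in> range ((#) y)"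
          using path_boundary_starts_with[of y "z # r"] by (rule rev_subsetD)
        moreover have "Suc (length zs) = length (y # z # r) \<and> set zs \<subseteq> set (y # z # r) \<and> distinct_adj zs"
        proof -
          have "distinct_adj (y # z # r)" "set (y # z # r) \<subseteq> M"
            using 1(2,3) by auto
          from 1(1)[OF this] zs(2) show ?thesis
            by blast
        qed
        ultimately show ?thesis
          using zs(1) 1(2) by (auto simp del: path_boundary.simps)
      qed
    qed
    then show ?case
      by blast
  qed auto
  show ?thesis
  proof
    fix c assume "c \<in> magnitude_boundaries k"
    then obtain b where b: "b \<in> carrier (magnitude_chain_group (Suc k))" "c = magnitude_boundary (Suc k) b"
      by (auto simp: magnitude_boundaries_def)
    then have cb: "c = frag_extend path_boundary b"
      by (simp only: magnitude_boundary_eq)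
    have "ys \<in> paths k" if ys: "ys \<in> Poly_Mapping.keys c" for ys
    proof -
      obtain xs where xs: "xs \<in> Poly_Mapping.keys b" "ys \<in> Poly_Mapping.keys (path_boundary xs)"
        using subsetD[OF keys_frag_extend ys[unfolded cb]] by blast
      have "length xs = Suc (Suc k)" "set xs \<subseteq> M" "distinct_adj xs"
        using xs(1) b(1) by (auto simp: magnitude_chain_group_def paths_eq)
      then show ?thesis
        using subsetD[OF face xs(2)] by (auto simp: paths_eq)
    qed
    then show "c \<in> carrier (magnitude_chain_group k)"
      by (auto simp: magnitude_chain_group_def)
  qed
qed

theorem corollary5p4:
  fixes M :: "'a set" and d :: "'a \<Rightarrow> 'a \<Rightarrow> real" and k :: nat
  assumes "Metric_space M d"
    and "Metric_space.median M d"
    and "Metric_space.Menger_convex M d"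
    and "k \<ge> 1"
  shows "trivial_group (Metric_space.magnitude_homology M d k)"
proof -
  interpret median_space M d
    using assms(1,2) by (simp add: median_space_def median_space_axioms_def)
  have "\<exists>u. first_step p V u" if "finite V" "V \<subseteq> M" "p \<in> M" for V p
    using first_step_exists[OF assms(3) that] by metis
  then have "magnitude_cycles k \<subseteq> magnitude_boundaries k"
    using cycle_is_boundary[OF _ assms(4)] by (intro subsetI) auto
  then show ?thesis
    using magnitude_boundaries_subset by (rule trivial_magnitude_homology)
qed

end
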